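(* Let $\lambda$ be a nonzero real number, $\gamma$ a complex number, and $Y$ a random variable as in the context. For every integer $n\ge0$, \[ C_{n,\lambda}^{(\gamma,Y)}=\sum_{k=0}^{n}\beta_{k,\lambda}^{(-\gamma,Y)}S_{1,\lambda}^{Y}(n,k). \]
   Context: $(x)_{0,\lambda}=1$, $(x)_{n,\lambda}=x(x-\lambda)\cdots(x-(n-1)\lambda)$ for $n\ge1$. $Y$ is a random variable whose moment-generating function $E[e^{tY}]$ exists for $|t|<r$ for some $r>0$, and $E[Y]\neq0$. $E[e_{\lambda}^{Y}(t)]$ denotes the formal power series $\sum_{n\ge0}E[(Y)_{n,\lambda}]\frac{t^n}{n!}$; $e_{Y,\lambda}(t)=E[e_{\lambda}^{Y}(t)]-1$ is a delta series with linear coefficient $E[Y]$, and the probabilistic degenerate logarithm $\log_{\lambda}^{Y}(1+t)$ is its compositional inverse. The probabilistic degenerate Stirling numbers of the first kind: $\frac1{k!}\big(\log_{\lambda}^{Y}(1+t)\big)^k=\sum_{n\ge k}S_{1,\lambda}^{Y}(n,k)\frac{t^n}{n!}$. The probabilistic degenerate Bernoulli numbers of order $\gamma$: $\big(\frac{t}{E[e_{\lambda}^{Y}(t)]-1}\big)^{\gamma}=\sum_{n\ge0}\beta_{n,\lambda}^{(\gamma,Y)}\frac{t^n}{n!}$. The probabilistic degenerate Cauchy numbers of order $\gamma$: $\big(\frac{t}{\log_{\lambda}^{Y}(1+t)}\big)^{\gamma}=\sum_{n\ge0}C_{n,\lambda}^{(\gamma,Y)}\frac{t^n}{n!}$. Complex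 powers of series with constant term $E[Y]^{\pm1}$ are taken as $c^{\gamma}(1+u)^{\gamma}=c^\gamma\sum_m\binom{\gamma}{m}u^m$ ($u(0)=0$), using one fixed determination of $E[Y]^{\gamma}$ for both $(E[Y])^{\gamma}$ and $(1/E[Y])^{-\gamma}$. *)

theory Defs
  imports "HOL-Probability.Probability" "HOL-Computational_Algebra.Formal_Power_Series"
begin

definition degen_ffact :: "real \<Rightarrow> real \<Rightarrow> nat \<Rightarrow> real" where
  "degen_ffact lam x n = (\<Prod>i<n. x - real i * lam)"

definition prob_degen_exp :: "'a measure \<Rightarrow> ('a \<Rightarrow> real) \<Rightarrow> real \<Rightarrow> complex fps" where
  "prob_degen_exp M Y lam =
     Abs_fps (\<lambda>n. complex_of_real (integral\<^sup>L M (\<lambda>\<omega>. degen_ffact lam (Y \<omega>) n)) / fact n)"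

definition prob_degen_delta :: "'a measure \<Rightarrow> ('a \<Rightarrow> real) \<Rightarrow> real \<Rightarrow> complex fps" where
  "prob_degen_delta M Y lam = prob_degen_exp M Y lam - 1"

text \<open>The series in \<open>t\<close> written \<open>log(1 + t)\<close> with decorations \<open>\<lambda>\<close> and \<open>Y\<close>;
  \<^const>\<open>fps_inv\<close> is the inverse with respect to composition.\<close>

definition prob_degen_log :: "'a measure \<Rightarrow> ('a \<Rightarrow> real) \<Rightarrow> real \<Rightarrow> complex fps" where
  "prob_degen_log M Y lam = fps_inv (prob_degen_delta M Y lam)"

definition prob_degen_stirling1 ::
    "'a measure \<Rightarrow> ('a \<Rightarrow> real) \<Rightarrow> real \<Rightarrow> nat \<Rightarrow> nat \<Rightarrow> complex" where
  "prob_degen_stirling1 M Y lam n k =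
     fact n * fps_nth (fps_const (1 / fact k) * prob_degen_log M Y lam ^ k) n"

text \<open>Complex powers of a series \<open>f = c (1 + u)\<close> with \<open>c \<noteq> 0\<close> and \<open>u(0) = 0\<close>:
  \<open>c\<^sup>\<gamma> (1 + u)\<^sup>\<gamma>\<close>, where \<open>c\<^sup>\<gamma> = exp (\<gamma> l)\<close> for a chosen
  logarithm \<open>l\<close> of \<open>c\<close>, i.e. \<open>exp l = c\<close>. The choice of \<open>l\<close> is the choice of the
  determination of \<open>c\<^sup>\<gamma>\<close>.\<close>

definition fps_cpow :: "complex \<Rightarrow> complex fps \<Rightarrow> complex \<Rightarrow> complex fps" where
  "fps_cpow l f \<gamma> =
     fps_const (exp (\<gamma> * l)) *
     fps_compose (fps_binomial \<gamma>) (fps_const (1 / fps_nth f 0) * f - 1)"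

text \<open>In both families below \<open>l\<close> is a logarithm of \<open>E[Y]\<close>. The series
  raised to the power \<open>\<gamma>\<close> has constant term \<open>1 / E[Y]\<close> in the Bernoulli case, so there the
  logarithm is \<open>- l\<close>. Hence \<open>E[Y]\<^sup>\<gamma>\<close> and \<open>(1 / E[Y])\<close> to the power \<open>- \<gamma>\<close>
  are the same number \<open>exp (\<gamma> l)\<close>.\<close>

definition prob_degen_bernoulli ::
    "'a measure \<Rightarrow> ('a \<Rightarrow> real) \<Rightarrow> real \<Rightarrow> complex \<Rightarrow> complex \<Rightarrow> nat \<Rightarrow> complex" where
  "prob_degen_bernoulli M Y lam l \<gamma> n =
     fact n * fps_nth (fps_cpow (- l) (fps_X / (prob_degen_exp M Y lam - 1)) \<gamma>) n"

definition prob_degen_cauchy ::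
    "'a measure \<Rightarrow> ('a \<Rightarrow> real) \<Rightarrow> real \<Rightarrow> complex \<Rightarrow> complex \<Rightarrow> nat \<Rightarrow> complex" where
  "prob_degen_cauchy M Y lam l \<gamma> n =
     fact n * fps_nth (fps_cpow l (fps_X / prob_degen_log M Y lam) \<gamma>) n"

end

theory Submission
  imports Defs
begin

text \<open>Write \<open>f\<close> for the delta series and \<open>g\<close> for its compositional inverse. Substituting
  \<open>g\<close> into \<open>t / f(t)\<close> gives \<open>g(t) / t\<close>, the reciprocal of \<open>t / g(t)\<close>. Hence the
  generating function of the Bernoulli numbers of order \<open>- \<gamma>\<close>, composed with \<open>g\<close>, is the
  generating function of the Cauchy numbers of order \<open>\<gamma>\<close>, and the claim is the comparison of
  coefficients.\<close>

text \<open>A series with nonzero linear coefficient has subdegree 0 or 1, so it divides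
  \<open>fps_X\<close> and the quotient is exact even when the series is not a unit.\<close>

lemma fps_X_divide_mult_cancel:
  fixes f :: "'a::field fps"
  assumes "fps_nth f 1 \<noteq> 0"
  shows "fps_X / f * f = fps_X"
proof -
  have "f \<noteq> 0" using assms by auto
  moreover have "subdegree f \<le> 1"
    using assms by (rule subdegree_leI)
  ultimately have "f dvd fps_X"
    by (simp add: fps_dvd_iff)
  then show ?thesis by simp
qed

text \<open>This is the law (1/(1+x))^(-c) = (1+x)^c for formal powers. As c is arbitrary, it comes
  from a differential equation: the left side satisfies a' = c a / (1+x), which fixes a series up to
  its constant term, here 1.\<close>

lemma fps_binomial_minus_compose_reciprocal:
  fixes c :: "'a::field_char_0"
  shows "fps_binomial (- c) oo (inverse (1 + fps_X) - 1) = fps_binomial c"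
proof -
  let ?w = "inverse (1 + fps_X) - 1 :: 'a fps"
  let ?a = "fps_binomial (- c) oo ?w"
  have w0: "fps_nth ?w 0 = 0" by simp
  have inv: "inverse (1 + fps_X :: 'a fps) * (1 + fps_X) = 1"
    by (rule inverse_mult_eq_1) simp
  have invinv: "inverse (inverse (1 + fps_X :: 'a fps)) = 1 + fps_X"
    by (rule fps_inverse_idempotent) simp
  \<comment> \<open>Here 1 + \<open>?w\<close> is the reciprocal of 1 + x, so taking the reciprocal
    again gives 1 + x back.\<close>
  have "inverse (1 + fps_X) oo ?w = inverse ((1 + fps_X) oo ?w)"
    using w0 by (intro fps_inverse_compose) auto
  also have "\<dots> = 1 + fps_X"
    using w0 invinv by (simp add: fps_compose_add_distrib)
  finally have comp: "inverse (1 + fps_X) oo ?w = 1 + fps_X" .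
  have dw: "fps_deriv ?w = - (inverse (1 + fps_X) ^ 2)"
    by (simp add: fps_inverse_deriv)
  have "fps_deriv (fps_binomial (- c)) = fps_const (- c) * fps_binomial (- c) * inverse (1 + fps_X)"
    by (subst fps_binomial_deriv) (simp add: fps_divide_unit)
  then have "fps_deriv ?a
      = (fps_const (- c) * fps_binomial (- c) * inverse (1 + fps_X) oo ?w) * fps_deriv ?w"
    by (simp only: fps_compose_deriv[OF w0])
  also have "\<dots> = fps_const (- c) * ?a * (1 + fps_X) * (- (inverse (1 + fps_X) ^ 2))"
    by (simp only: fps_compose_mult_distrib[OF w0] fps_const_compose comp dw)
  \<comment> \<open>The two signs cancel, and one of the two reciprocals is set aside to absorb the
    factor 1 + x.\<close>
  also have "\<dots> = fps_const c * ?a * inverse (1 + fps_X) * (inverse (1 + fps_X) * (1 + fps_X))"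
    by (simp add: power2_eq_square algebra_simps flip: fps_const_neg)
  also have "\<dots> = fps_const c * ?a / (1 + fps_X)"
    by (simp add: inv fps_divide_unit)
  finally have "?a = fps_const (fps_nth ?a 0) * fps_binomial c"
    by (simp only: fps_binomial_ODE_unique)
  then show ?thesis by simp
qed

lemma fps_binomial_minus_compose_inverse:
  fixes u :: "'a::field_char_0 fps"
  assumes "fps_nth u 0 = 1"
  shows "fps_binomial (- c) oo (inverse u - 1) = fps_binomial c oo (u - 1)"
proof -
  have u0: "fps_nth (u - 1) 0 = 0" using assms by simp
  have "(inverse (1 + fps_X) - 1) oo (u - 1) = inverse u - 1"
    using u0 by (simp add: fps_compose_sub_distrib fps_inverse_compose fps_compose_add_distrib)
  then show ?thesis
    using fps_compose_assoc[OF u0, of "inverse (1 + fps_X) - 1" "fps_binomial (- c)"]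
    by (simp add: fps_binomial_minus_compose_reciprocal)
qed

text \<open>The constant terms of \<open>h\<close> and \<open>q\<close> are reciprocal, so after
  normalisation to constant term 1 the two bases are reciprocal as well, and the binomial law
  applies.\<close>

lemma fps_cpow_uminus_compose:
  assumes g0: "fps_nth g 0 = 0" and hq: "(h oo g) * q = 1"
  shows "fps_cpow (- l) h (- \<gamma>) oo g = fps_cpow l q \<gamma>"
proof -
  define a where "a = fps_nth h 0"
  have aq: "a * fps_nth q 0 = 1"
    using arg_cong[OF hq, of "\<lambda>s. fps_nth s 0"] by (simp add: a_def)
  then have a: "a \<noteq> 0" by auto
  then have q0: "fps_nth q 0 = 1 / a"
    using aq by (simp add: eq_divide_eq mult.commute)
  let ?u = "fps_const a * q"
  have "fps_const (1 / a) * (h oo g) * ?u = fps_const (1 / a) * fps_const a * ((h oo g) * q)"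
    by (simp only: mult_ac)
  also have "\<dots> = 1"
    using a by (simp add: hq)
  finally have "fps_const (1 / a) * (h oo g) = inverse ?u"
    by (metis fps_inverse_unique mult.commute)
  then have base: "(fps_const (1 / a) * h - 1) oo g = inverse ?u - 1"
    using g0 by (simp add: fps_compose_sub_distrib fps_compose_mult_distrib)
  \<comment> \<open>Both powers use the same determination: the signs of the exponent and of the
    logarithm cancel in the scalar \<open>exp (\<gamma> * l)\<close>.\<close>
  have "fps_cpow (- l) h (- \<gamma>) oo g
      = fps_const (exp (\<gamma> * l)) * (fps_binomial (- \<gamma>) oo (inverse ?u - 1))"
    using g0 a fps_compose_assoc[OF g0, of "fps_const (1 / a) * h - 1" "fps_binomial (- \<gamma>)"]
    by (simp add: fps_cpow_def fps_compose_mult_distrib base flip: a_def)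
  also have "\<dots> = fps_const (exp (\<gamma> * l)) * (fps_binomial \<gamma> oo (?u - 1))"
    using aq by (subst fps_binomial_minus_compose_inverse) simp_all
  finally show ?thesis
    by (simp add: fps_cpow_def q0)
qed

lemma prob_degen_delta_nth_0:
  assumes "prob_space M"
  shows "fps_nth (prob_degen_delta M Y lam) 0 = 0"
proof -
  interpret prob_space M by fact
  show ?thesis
    by (simp add: prob_degen_delta_def prob_degen_exp_def degen_ffact_def prob_space)
qed

lemma prob_degen_delta_nth_1:
  "fps_nth (prob_degen_delta M Y lam) 1 = complex_of_real (integral\<^sup>L M Y)"
  by (simp add: prob_degen_delta_def prob_degen_exp_def degen_ffact_def)

theorem theorem4p3:
  fixes M :: "'a measure" and Y :: "'a \<Rightarrow> real" and lam :: real
    and \<gamma> l :: complex and n :: nat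
  assumes "prob_space M"
    and "Y \<in> borel_measurable M"
    and mgf: "\<exists>r>0. \<forall>t::real. \<bar>t\<bar> < r \<longrightarrow> integrable M (\<lambda>\<omega>. exp (t * Y \<omega>))"
    and "integral\<^sup>L M Y \<noteq> 0"
    and "lam \<noteq> 0"
    and "exp l = complex_of_real (integral\<^sup>L M Y)"
  shows "prob_degen_cauchy M Y lam l \<gamma> n =
    (\<Sum>k=0..n. prob_degen_bernoulli M Y lam l (- \<gamma>) k * prob_degen_stirling1 M Y lam n k)"
proof -
  define f where "f = prob_degen_delta M Y lam"
  define g where "g = fps_inv f"
  define B where "B = fps_cpow (- l) (fps_X / f) (- \<gamma>)"
  have f0: "fps_nth f 0 = 0" and f1: "fps_nth f 1 \<noteq> 0"
    using assms by (simp_all only: f_def prob_degen_delta_nth_0 prob_degen_delta_nth_1) simp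
  have g0: "fps_nth g 0 = 0" by (simp add: g_def fps_inv_def)
  have g1: "fps_nth g 1 \<noteq> 0" using f1 by (simp add: g_def fps_inv_def)
  have fg: "f oo g = fps_X"
    unfolding g_def using f0 f1 by (rule fps_inv_right)
  \<comment> \<open>Since \<open>f\<close> is not a unit, the quotient is not composed directly: it
    is first multiplied by \<open>f\<close>, which becomes \<open>fps_X\<close> under substitution
    of \<open>g\<close>.\<close>
  have "(fps_X / f oo g) * fps_X = (fps_X / f * f) oo g"
    by (simp add: fps_compose_mult_distrib[OF g0] fg)
  also have "\<dots> = g"
    by (simp only: fps_X_divide_mult_cancel[OF f1]) (simp add: g0)
  finally have "(fps_X / f oo g) * (fps_X / g) * fps_X = fps_X / g * g"
    by (metis mult.assoc mult.commute)
  also have "\<dots> = 1 * fps_X"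
    by (simp only: fps_X_divide_mult_cancel[OF g1] mult_1)
  finally have "(fps_X / f oo g) * (fps_X / g) = 1"
    by (simp only: mult_right_cancel[OF fps_X_neq_zero])
  then have B: "B oo g = fps_cpow l (fps_X / g) \<gamma>"
    unfolding B_def by (rule fps_cpow_uminus_compose[OF g0])
  have "prob_degen_cauchy M Y lam l \<gamma> n = fact n * fps_nth (B oo g) n"
    by (simp add: prob_degen_cauchy_def prob_degen_log_def B flip: f_def g_def)
  \<comment> \<open>The factor \<open>fact k\<close> and its reciprocal are inserted to turn
    ordinary coefficients into the exponential ones that define both families of numbers.\<close>
  also have "\<dots> = (\<Sum>k=0..n. (fact k * fps_nth B k) * (fact n * (1 / fact k * fps_nth (g ^ k) n)))"
    by (simp add: fps_compose_nth sum_distrib_left mult_ac)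
  also have "\<dots> = (\<Sum>k=0..n. prob_degen_bernoulli M Y lam l (- \<gamma>) k
      * prob_degen_stirling1 M Y lam n k)"
    by (simp add: prob_degen_bernoulli_def prob_degen_stirling1_def prob_degen_log_def
        B_def f_def g_def prob_degen_delta_def)
  finally show ?thesis .
qed

end
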